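(* Let $k$ and $c$ be positive integers and let $G$ be a finite, simple, undirected $2k$-regular graph with girth $g(G) \ge 2k/c$. Then $la(G) \le k+\left\lceil \frac{3c+2}{2}\right\rceil$.
   Context: The girth $g(G)$ is the length of a shortest cycle in $G$; the inequality $g(G)\ge 2k/c$ is between real numbers. A linear forest is a graph in which every connected component is a path (a single vertex counts as a path). The linear arboricity $la(G)$ is the minimum number of linear forests whose edge sets partition the edge set $E(G)$. *)

theory Defs
  imports Complex_Main "HOL-Library.Extended_Real"
begin

text \<open>An undirected simple graph is given by its vertex set \<open>V\<close> and its set \<open>E\<close> of two-element edges.\<close>

definition fin_simple_graph :: "'a set \<Rightarrow> 'a set set \<Rightarrow> bool" where
  "fin_simple_graph V E \<longleftrightarrow> finite V \<and> (\<forall>e\<in>E. e \<subseteq> V \<and> card e = 2)"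

definition vertex_degree :: "'a set set \<Rightarrow> 'a \<Rightarrow> nat" where
  "vertex_degree E v = card {e \<in> E. v \<in> e}"

definition regular_graph :: "nat \<Rightarrow> 'a set \<Rightarrow> 'a set set \<Rightarrow> bool" where
  "regular_graph d V E \<longleftrightarrow> (\<forall>v\<in>V. vertex_degree E v = d)"

definition is_cycle :: "'a set set \<Rightarrow> 'a list \<Rightarrow> bool" where
  "is_cycle E vs \<longleftrightarrow> length vs \<ge> 3 \<and> distinct vs \<and>
     (\<forall>i<length vs. {vs ! i, vs ! (Suc i mod length vs)} \<in> E)"

text \<open>The girth of an acyclic graph is \<open>\<infinity>\<close>.\<close>

definition girth :: "'a set set \<Rightarrow> enat" where
  "girth E = (INF vs\<in>{vs. is_cycle E vs}. enat (length vs))"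

definition reachable :: "'a set set \<Rightarrow> 'a \<Rightarrow> 'a \<Rightarrow> bool" where
  "reachable E = (\<lambda>u v. {u, v} \<in> E)\<^sup>*\<^sup>*"

definition graph_components :: "'a set \<Rightarrow> 'a set set \<Rightarrow> 'a set set" where
  "graph_components V E = {{v \<in> V. reachable E u v} | u. u \<in> V}"

definition induced_edges :: "'a set set \<Rightarrow> 'a set \<Rightarrow> 'a set set" where
  "induced_edges E C = {e \<in> E. e \<subseteq> C}"

definition is_path_graph :: "'a set \<Rightarrow> 'a set set \<Rightarrow> bool" where
  "is_path_graph V E \<longleftrightarrow> (\<exists>vs. vs \<noteq> [] \<and> distinct vs \<and> set vs = V \<and>
     E = {{vs ! i, vs ! Suc i} | i. Suc i < length vs})"

definition linear_forest :: "'a set \<Rightarrow> 'a set set \<Rightarrow> bool" where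
  "linear_forest V E \<longleftrightarrow> fin_simple_graph V E \<and>
     (\<forall>C\<in>graph_components V E. is_path_graph C (induced_edges E C))"

text \<open>The forests need not span \<open>V\<close>, and parts of the decomposition may be empty;
  neither affects the minimum.\<close>

definition linear_forest_decomposition ::
    "'a set \<Rightarrow> 'a set set \<Rightarrow> nat \<Rightarrow> (nat \<Rightarrow> 'a set) \<Rightarrow> (nat \<Rightarrow> 'a set set) \<Rightarrow> bool" where
  "linear_forest_decomposition V E n W F \<longleftrightarrow>
     (\<forall>i<n. W i \<subseteq> V \<and> linear_forest (W i) (F i)) \<and>
     (\<forall>i<n. \<forall>j<n. i \<noteq> j \<longrightarrow> F i \<inter> F j = {}) \<and>
     (\<Union>i<n. F i) = E"

definition linear_arboricity :: "'a set \<Rightarrow> 'a set set \<Rightarrow> nat" where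
  "linear_arboricity V E = (LEAST n. \<exists>W F. linear_forest_decomposition V E n W F)"

text \<open>The set over which the minimum is taken is nonempty.\<close>

lemma linear_forest_single_edge:
  assumes "card e = 2"
  shows "linear_forest e {e}"
proof -
  obtain a b where e: "e = {a, b}" and ab: "a \<noteq> b"
    using assms by (auto simp: card_2_iff)
  have r: "reachable {e} u v" if "u \<in> e" "v \<in> e" for u v
    using that ab unfolding reachable_def e by (cases "u = v") (auto intro!: r_into_rtranclp)
  have "C = e" if "C \<in> graph_components e {e}" for C
    using that r by (auto simp: graph_components_def)
  moreover have "is_path_graph e (induced_edges {e} e)"
    unfolding is_path_graph_def induced_edges_def
    by (rule exI[of _ "[a, b]"]) (use ab in \<open>auto simp: e\<close>)
  ultimately show ?thesis
    using assms by (auto simp: linear_forest_def fin_simple_graph_def e)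
qed

lemma linear_forest_decomposition_exists:
  assumes "fin_simple_graph V E"
  shows "\<exists>n W F. linear_forest_decomposition V E n W F"
proof -
  have "finite E"
    using assms by (auto simp: fin_simple_graph_def intro: finite_subset[of E "Pow V"])
  then obtain f n where f: "E = f ` {i::nat. i < n}" "inj_on f {i. i < n}"
    using finite_imp_nat_seg_image_inj_on by metis
  have "linear_forest_decomposition V E n f (\<lambda>i. {f i})"
    using assms f linear_forest_single_edge
    by (auto simp: linear_forest_decomposition_def fin_simple_graph_def inj_on_def)
  then show ?thesis by blast
qed

end

theory Submission
  imports Defs "HOL-Combinatorics.Orbits"
begin

text \<open>An Eulerian orientation splits \<open>E\<close> into \<open>k\<close> permutations of \<open>V\<close>, each of whose orbits is a cycle
  of length at least \<open>2 * k / c\<close>. Giving every arc the reciprocal of the length of its cycle puts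
  total weight 1 on each cycle and weight at most \<open>c\<close> around each vertex. Iterated rounding of
  this fractional solution selects one edge from each cycle so that the selected edges have
  maximum degree at most \<open>c + 2\<close>. Deleting them turns the \<open>k\<close> permutations into linear forests, and
  a graph of maximum degree \<open>d\<close> is greedily split into \<open>d\<close> linear forests. The total
  \<open>k + c + 2\<close> is at most \<open>k + \<lceil>(3 * c + 2) / 2\<rceil>\<close> because \<open>c \<ge> 1\<close>.\<close>

section \<open>Linear systems\<close>

text \<open>The obstacle is that choices made cycle by cycle may pile up at one vertex; all cycles
  have to be treated in a single rounding. \<open>bounded_degree_rounding\<close> keeps every part
  sum exact and overshoots a vertex bound by at most \<open>2 * r - 2\<close>, where
  \<open>r\<close> is the number of vertices that an element touches. For \<open>r = 1\<close>
  nothing is lost, and the same lemma then produces integral matchings: weight 1/2 on both ends of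
  each edge rounds to the orientation, and equal weights on all arcs of a regular digraph round to a
  permutation. Only the selection of one edge per cycle has \<open>r = 2\<close>, an edge having two
  ends, and this is where the 2 in \<open>c + 2\<close> comes from. The orientation has no loops and
  no opposite arcs, so every orbit has at least three elements and is a genuine cycle of the graph,
  to which the girth bound applies.\<close>

lemma homogeneous_system_nontrivial:
  fixes a :: "'j \<Rightarrow> 'e \<Rightarrow> real"
  assumes "finite J" "finite F" "card J < card F"
  shows "\<exists>y. (\<exists>e\<in>F. y e \<noteq> 0) \<and> (\<forall>j\<in>J. (\<Sum>e\<in>F. a j e * y e) = 0)"
  using assms
proof (induction J arbitrary: F a rule: finite_induct)
  case empty
  then have "F \<noteq> {}" by auto
  then show ?case by (intro exI[of _ "\<lambda>_. 1"]) auto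
next
  case (insert j J)
  show ?case
  proof (cases "\<forall>e\<in>F. a j e = 0")
    case True
    obtain y where "\<exists>e\<in>F. y e \<noteq> 0" "\<forall>i\<in>J. (\<Sum>e\<in>F. a i e * y e) = 0"
      using insert.IH[of F a] insert.prems insert.hyps by auto
    with True show ?thesis by (intro exI[of _ y]) auto
  next
    case False
    then obtain d where d: "d \<in> F" "a j d \<noteq> 0" by blast
    \<comment> \<open>Gaussian elimination: the multiple of row \<open>j\<close> that is subtracted
      from row \<open>i\<close> makes its coefficient at the pivot \<open>d\<close> vanish.\<close>
    define a' where "a' = (\<lambda>i e. a i e - a i d * a j e / a j d)"
    have "card J < card (F - {d})"
      using insert.prems insert.hyps d card_Suc_Diff1[OF insert.prems(1) d(1)] by simp
    then obtain y where y: "\<exists>e\<in>F - {d}. y e \<noteq> 0"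
        "\<forall>i\<in>J. (\<Sum>e\<in>F - {d}. a' i e * y e) = 0"
      using insert.IH[of "F - {d}" a'] insert.prems by blast
    define s where "s = (\<Sum>e\<in>F - {d}. a j e * y e)"
    \<comment> \<open>The value at \<open>d\<close> is the one that solves equation \<open>j\<close>
      once the other unknowns are fixed.\<close>
    define z where "z = y(d := - s / a j d)"
    have split: "(\<Sum>e\<in>F. a i e * z e) = (\<Sum>e\<in>F - {d}. a i e * y e) - a i d * s / a j d" for i
    proof -
      have "(\<Sum>e\<in>F. a i e * z e) = a i d * z d + (\<Sum>e\<in>F - {d}. a i e * z e)"
        using d insert.prems by (simp add: sum.remove)
      moreover have "(\<Sum>e\<in>F - {d}. a i e * z e) = (\<Sum>e\<in>F - {d}. a i e * y e)"
        by (intro sum.cong) (auto simp: z_def)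
      ultimately show ?thesis by (simp add: z_def)
    qed
    have "(\<Sum>e\<in>F. a i e * z e) = 0" if "i \<in> J" for i
    proof -
      have "(\<Sum>e\<in>F - {d}. a' i e * y e)
          = (\<Sum>e\<in>F - {d}. a i e * y e) - a i d / a j d * s"
        by (simp add: a'_def s_def algebra_simps sum_subtractf sum_distrib_left)
      with y that split[of i] show ?thesis by simp
    qed
    moreover have "(\<Sum>e\<in>F. a j e * z e) = 0"
      using split[of j] d by (simp add: s_def)
    moreover have "\<exists>e\<in>F. z e \<noteq> 0"
      using y by (auto simp: z_def)
    ultimately show ?thesis by blast
  qed
qed

lemma dependent_system_nontrivial:
  fixes a :: "'j \<Rightarrow> 'e \<Rightarrow> real"
  assumes "finite J" "finite F" "card J \<le> card F"
    and "j \<in> J" "l j \<noteq> 0" and dep: "\<And>e. e \<in> F \<Longrightarrow> (\<Sum>i\<in>J. l i * a i e) = 0"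
  shows "\<exists>y. (\<exists>e\<in>F. y e \<noteq> 0) \<and> (\<forall>i\<in>J. (\<Sum>e\<in>F. a i e * y e) = 0)"
proof -
  have "card (J - {j}) < card F"
    using assms by (meson card_Diff1_less order_less_le_trans)
  then obtain y where y: "\<exists>e\<in>F. y e \<noteq> 0" "\<forall>i\<in>J - {j}. (\<Sum>e\<in>F. a i e * y e) = 0"
    using homogeneous_system_nontrivial[of "J - {j}" F a] assms by auto
  have "0 = (\<Sum>e\<in>F. (\<Sum>i\<in>J. l i * a i e) * y e)"
    using dep by simp
  also have "\<dots> = (\<Sum>i\<in>J. l i * (\<Sum>e\<in>F. a i e * y e))"
    unfolding sum_distrib_left sum_distrib_right by (subst sum.swap) (simp add: mult_ac)
  also have "\<dots> = l j * (\<Sum>e\<in>F. a j e * y e) + (\<Sum>i\<in>J - {j}. l i * (\<Sum>e\<in>F. a i e * y e))"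
    using assms by (simp add: sum.remove)
  also have "(\<Sum>i\<in>J - {j}. l i * (\<Sum>e\<in>F. a i e * y e)) = 0"
    using y by (intro sum.neutral) auto
  finally have "(\<Sum>e\<in>F. a j e * y e) = 0"
    using assms by simp
  with y show ?thesis by (intro exI[of _ y]) auto
qed

text \<open>A point in the interior of the cube moves along \<open>y\<close> until it first meets a
  face.\<close>

lemma shift_to_boundary:
  fixes x y :: "'e \<Rightarrow> real"
  assumes "finite F" and x: "\<And>e. e \<in> F \<Longrightarrow> 0 < x e \<and> x e < 1" and "\<exists>e\<in>F. y e \<noteq> 0"
  shows "\<exists>t. (\<forall>e\<in>F. 0 \<le> x e + t * y e \<and> x e + t * y e \<le> 1) \<and>
    (\<exists>e\<in>F. x e + t * y e = 0 \<or> x e + t * y e = 1)"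
proof -
  \<comment> \<open>\<open>q e\<close> is the time at which coordinate \<open>e\<close> reaches the
    face it moves towards: 1 if it increases, 0 if it decreases. The earliest of these times is
    \<open>t\<close>.\<close>
  define q where "q = (\<lambda>e. if y e > 0 then (1 - x e) / y e else x e / (- y e))"
  define F' where "F' = {e \<in> F. y e \<noteq> 0}"
  define t where "t = Min (q ` F')"
  have fin: "finite (q ` F')" "q ` F' \<noteq> {}"
    using assms by (auto simp: F'_def)
  have q0: "q e > 0" if "e \<in> F'" for e
    using that x by (auto simp: q_def F'_def divide_simps not_less less_le)
  have t0: "t > 0"
    using fin q0 by (auto simp: t_def)
  have tq: "t \<le> q e" if "e \<in> F'" for e
    using fin that by (simp add: t_def)
  obtain e where e: "e \<in> F'" "t = q e"
    using Min_in[OF fin] by (auto simp: t_def)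
  have "x e + t * y e = 0 \<or> x e + t * y e = 1"
    using e by (auto simp: q_def F'_def)
  moreover have "0 \<le> x d + t * y d \<and> x d + t * y d \<le> 1" if d: "d \<in> F" for d
  proof -
    consider "y d = 0" | "y d > 0" | "y d < 0" by linarith
    then show ?thesis
    proof cases
      case 1
      then show ?thesis using x[OF d] by simp
    next
      case 2
      then have "t \<le> (1 - x d) / y d" using tq[of d] d by (simp add: F'_def q_def)
      then have "t * y d \<le> 1 - x d" using 2 by (simp add: field_simps)
      moreover have "t * y d > 0" using 2 t0 by simp
      ultimately show ?thesis using x[OF d] by linarith
    next
      case 3
      then have "t \<le> x d / (- y d)" using tq[of d] d by (simp add: F'_def q_def)
      then have "t * (- y d) \<le> x d" using 3 by (subst (asm) pos_le_divide_eq) auto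
      moreover have "t * y d < 0" using 3 t0 by (simp add: mult_less_0_iff)
      ultimately show ?thesis using x[OF d] by simp
    qed
  qed
  ultimately show ?thesis using e by (auto simp: F'_def)
qed

section \<open>Rounding\<close>

lemma sum_of_bool_eq_card:
  "finite A \<Longrightarrow> (\<Sum>e\<in>A. of_bool (P e)) = (of_nat (card {e \<in> A. P e}) :: 'b::semiring_1)"
  by (simp add: sum.If_cases of_bool_def Int_def)

lemma double_count_incidences:
  assumes "finite F" "finite L"
  shows "(\<Sum>v\<in>L. card {e \<in> F. v \<in> Q e}) = (\<Sum>e\<in>F. card (Q e \<inter> L))"
proof -
  have "(\<Sum>v\<in>L. card {e \<in> F. v \<in> Q e}) = (\<Sum>v\<in>L. \<Sum>e\<in>F. of_bool (v \<in> Q e))"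
    using assms by (simp add: sum_of_bool_eq_card del: sum_of_bool_eq)
  also have "\<dots> = (\<Sum>e\<in>F. \<Sum>v\<in>L. of_bool (v \<in> Q e))"
    by (rule sum.swap)
  also have "\<dots> = (\<Sum>e\<in>F. card (Q e \<inter> L))"
    using assms by (auto simp: sum_of_bool_eq_card Int_def conj_commute simp del: sum_of_bool_eq intro!: sum.cong)
  finally show ?thesis .
qed

text \<open>The dimension count behind the rounding: there are at most \<open>card F\<close> constraints, and in the
  extremal case the part constraints and the vertex constraints both cover every element of \<open>F\<close>
  uniformly, so that they are linearly dependent.\<close>

lemma balanced_direction:
  fixes p :: "'e \<Rightarrow> 'i" and Q :: "'e \<Rightarrow> 'v set"
  assumes F: "finite F" "F \<noteq> {}" and r: "r > 0"
    and Q: "\<And>e. e \<in> F \<Longrightarrow> finite (Q e) \<and> card (Q e) = r"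
    and p: "\<And>e. e \<in> F \<Longrightarrow> \<exists>d\<in>F. d \<noteq> e \<and> p d = p e"
  shows "\<exists>y :: 'e \<Rightarrow> real. (\<exists>e\<in>F. y e \<noteq> 0) \<and> (\<forall>i. (\<Sum>e | e \<in> F \<and> p e = i. y e) = 0) \<and>
    (\<forall>v. card {e \<in> F. v \<in> Q e} \<ge> 2 * r \<longrightarrow> (\<Sum>e | e \<in> F \<and> v \<in> Q e. y e) = 0)"
proof -
  define L where "L = {v. card {e \<in> F. v \<in> Q e} \<ge> 2 * r}"
  \<comment> \<open>One equation per part that meets \<open>F\<close> and one per vertex in
    \<open>L\<close>; the sum type keeps the two kinds apart.\<close>
  define J where "J = Inl ` p ` F \<union> Inr ` L"
  define a :: "'i + 'v \<Rightarrow> 'e \<Rightarrow> real" where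
    "a = (\<lambda>j e. case j of Inl i \<Rightarrow> of_bool (p e = i) | Inr v \<Rightarrow> of_bool (v \<in> Q e))"
  have "v \<in> \<Union> (Q ` F)" if "v \<in> L" for v
  proof (rule ccontr)
    assume "v \<notin> \<Union> (Q ` F)"
    then have "{e \<in> F. v \<in> Q e} = {}" by auto
    then have "card {e \<in> F. v \<in> Q e} = 0" by (simp only: card.empty)
    then show False using that r unfolding L_def by simp
  qed
  then have finL: "finite L"
    using F Q by (intro finite_subset[of L "\<Union> (Q ` F)"]) auto
  have finJ: "finite J"
    using F finL by (simp add: J_def)
  have cardJ: "card J = card (p ` F) + card L"
    unfolding J_def using F finL by (subst card_Un_disjoint) (auto simp: card_image)
  have parts: "2 * card (p ` F) \<le> card F"
  proof -
    have "2 \<le> card {e \<in> F. p e = i}" if i: "i \<in> p ` F" for i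
    proof -
      obtain e where "e \<in> F" "p e = i" using i by blast
      moreover obtain d where "d \<in> F" "d \<noteq> e" "p d = p e" using p \<open>e \<in> F\<close> by blast
      ultimately have "card {d, e} \<le> card {e \<in> F. p e = i}"
        using F by (intro card_mono) auto
      then show ?thesis using \<open>d \<noteq> e\<close> by simp
    qed
    then have "(\<Sum>i\<in>p ` F. 2) \<le> (\<Sum>i\<in>p ` F. card {e \<in> F. p e = i})"
      by (intro sum_mono) auto
    also have "\<dots> = card F"
      using sum.image_gen[OF F(1), of "\<lambda>_. 1::nat" p] by simp
    finally show ?thesis by simp
  qed
  have "2 * r * card L \<le> (\<Sum>v\<in>L. card {e \<in> F. v \<in> Q e})"
    using sum_mono[of L "\<lambda>_. 2 * r" "\<lambda>v. card {e \<in> F. v \<in> Q e}"] by (simp add: L_def mult.commute)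
  then have verts: "2 * r * card L \<le> (\<Sum>e\<in>F. card (Q e \<inter> L))"
    using double_count_incidences[OF F(1) finL, of Q] by simp
  have QL: "card (Q e \<inter> L) \<le> r" if "e \<in> F" for e
    using Q[OF that] by (metis card_mono inf_le1)
  then have total: "(\<Sum>e\<in>F. card (Q e \<inter> L)) \<le> r * card F"
    using sum_mono[of F "\<lambda>e. card (Q e \<inter> L)" "\<lambda>_. r"] by (simp add: mult.commute)
  have L_le: "2 * card L \<le> card F"
  proof -
    have "r * (2 * card L) \<le> r * card F"
      using order_trans[OF verts total] by (simp only: mult_ac)
    then show ?thesis using r by simp
  qed
  have "\<exists>y. (\<exists>e\<in>F. y e \<noteq> 0) \<and> (\<forall>j\<in>J. (\<Sum>e\<in>F. a j e * y e) = 0)"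
  proof (cases "card J < card F")
    case True
    then show ?thesis by (rule homogeneous_system_nontrivial[OF finJ F(1)])
  next
    case False
    with parts L_le cardJ have "2 * card L = card F" by linarith
    then have "2 * r * card L = r * card F" by (metis mult.assoc mult.commute)
    then have "(\<Sum>e\<in>F. card (Q e \<inter> L)) = card F * r"
      using verts total by (metis le_antisym mult.commute)
    then have eq: "(\<Sum>e\<in>F. card (Q e \<inter> L)) = (\<Sum>e\<in>F. r)" by simp
    have QL_eq: "card (Q e \<inter> L) = r" if "e \<in> F" for e
      using sum_mono_inv[OF eq QL that F(1)] by simp
    obtain e0 where e0: "e0 \<in> F" using F by blast
    \<comment> \<open>Each element occurs in one part row and in \<open>r\<close> vertex rows, so
      the sum of all vertex rows is \<open>r\<close> times the sum of all part rows.\<close>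
    define l :: "'i + 'v \<Rightarrow> real" where "l = case_sum (\<lambda>_. - real r) (\<lambda>_. 1)"
    have "(\<Sum>j\<in>J. l j * a j e) = 0" if e: "e \<in> F" for e
    proof -
      have "(\<Sum>j\<in>J. l j * a j e) = (\<Sum>i\<in>p ` F. l (Inl i) * a (Inl i) e) + (\<Sum>v\<in>L. l (Inr v) * a (Inr v) e)"
        unfolding J_def using F finL
        by (subst sum.union_disjoint) (auto simp: sum.reindex)
      also have "(\<Sum>i\<in>p ` F. l (Inl i) * a (Inl i) e) = - real r * (\<Sum>i\<in>p ` F. of_bool (p e = i))"
        by (simp add: l_def a_def sum_distrib_left)
      also have "(\<Sum>i\<in>p ` F. of_bool (p e = i)) = (1::real)"
        using F e by (simp add: of_bool_def)
      also have "(\<Sum>v\<in>L. l (Inr v) * a (Inr v) e) = (\<Sum>v\<in>L. of_bool (v \<in> Q e))"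
        by (simp add: l_def a_def del: sum_of_bool_eq)
      also have "\<dots> = real (card (Q e \<inter> L))"
        using finL by (simp add: sum_of_bool_eq_card Int_def conj_commute del: sum_of_bool_eq)
      finally show ?thesis using QL_eq[OF e] by simp
    qed
    then show ?thesis
      using e0 r parts L_le cardJ
      by (intro dependent_system_nontrivial[where j = "Inl (p e0)" and l = l] finJ F)
        (auto simp: J_def l_def)
  qed
  then obtain y where y: "\<exists>e\<in>F. y e \<noteq> 0" "\<And>j. j \<in> J \<Longrightarrow> (\<Sum>e\<in>F. a j e * y e) = 0"
    by blast
  have restrict: "(\<Sum>e\<in>F. of_bool (P e) * y e) = (\<Sum>e | e \<in> F \<and> P e. y e)" for P
  proof -
    have "(\<Sum>e\<in>F. of_bool (P e) * y e) = (\<Sum>e\<in>F. if P e then y e else 0)"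
      by (intro sum.cong) auto
    then show ?thesis using F by (simp add: sum.inter_filter)
  qed
  have "(\<Sum>e | e \<in> F \<and> p e = i. y e) = 0" for i
  proof (cases "i \<in> p ` F")
    case True
    then show ?thesis using y(2)[of "Inl i"] restrict[of "\<lambda>e. p e = i"] by (simp add: J_def a_def)
  next
    case False
    then have "{e. e \<in> F \<and> p e = i} = {}" by auto
    then show ?thesis by (simp only: sum.empty)
  qed
  moreover have "(\<Sum>e | e \<in> F \<and> v \<in> Q e. y e) = 0" if "card {e \<in> F. v \<in> Q e} \<ge> 2 * r" for v
    using y(2)[of "Inr v"] that restrict[of "\<lambda>e. v \<in> Q e"] by (simp add: J_def a_def L_def)
  ultimately show ?thesis using y(1) by blast
qed

text \<open>While an element is fractional, a part sum, being an integer, has at least two fractional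
  elements, so \<open>balanced_direction\<close> applies. A vertex constraint is given up only when fewer than
  \<open>2 * r\<close> of its elements are fractional; from then on the size of the support at that vertex,
  which can only shrink, controls it.\<close>

lemma bounded_degree_rounding:
  fixes p :: "'e \<Rightarrow> 'i" and Q :: "'e \<Rightarrow> 'v set" and x :: "'e \<Rightarrow> real" and n b :: "_ \<Rightarrow> nat"
  assumes X: "finite X" and r: "r > 0"
    and Q: "\<And>e. e \<in> X \<Longrightarrow> finite (Q e) \<and> card (Q e) = r"
    and x: "\<And>e. e \<in> X \<Longrightarrow> 0 \<le> x e \<and> x e \<le> 1"
    and parts: "\<And>i. (\<Sum>e | e \<in> X \<and> p e = i. x e) = real (n i)"
    and verts: "\<And>v. (\<Sum>e | e \<in> X \<and> v \<in> Q e. x e) \<le> real (b v) \<or>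
        card {e \<in> X. v \<in> Q e \<and> x e > 0} \<le> b v + 2 * r - 2"
  shows "\<exists>S\<subseteq>X. (\<forall>i. card {e \<in> S. p e = i} = n i) \<and>
    (\<forall>v. card {e \<in> S. v \<in> Q e} \<le> b v + 2 * r - 2)"
  using x parts verts
proof (induction "card {e \<in> X. 0 < x e \<and> x e < 1}" arbitrary: x rule: less_induct)
  case less
  define F where "F = {e \<in> X. 0 < x e \<and> x e < 1}"
  have finF: "finite F" and FX: "F \<subseteq> X" using X by (auto simp: F_def)
  have int: "x e = of_bool (x e > 0)" if "e \<in> X - F" for e
    using that less.prems(1)[of e] by (auto simp: F_def)
  show ?case
  proof (cases "F = {}")
    case True
    define S where "S = {e \<in> X. x e > 0}"
    have count: "(\<Sum>e | e \<in> X \<and> P e. x e) = real (card {e \<in> S. P e})" for P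
    proof -
      have "(\<Sum>e | e \<in> X \<and> P e. x e) = (\<Sum>e | e \<in> X \<and> P e. of_bool (x e > 0))"
        by (intro sum.cong refl int) (use True in auto)
      also have "\<dots> = real (card {e \<in> S. P e})"
        using X by (auto simp: sum_of_bool_eq_card S_def simp del: sum_of_bool_eq intro!: arg_cong[where f=card])
      finally show ?thesis .
    qed
    show ?thesis
    proof (intro exI[of _ S] conjI allI)
      show "S \<subseteq> X" by (auto simp: S_def)
      show "card {e \<in> S. p e = i} = n i" for i
        using less.prems(2)[of i] count[of "\<lambda>e. p e = i"] by simp
      have "{e \<in> S. v \<in> Q e} = {e \<in> X. v \<in> Q e \<and> x e > 0}" for v
        by (auto simp: S_def)
      \<comment> \<open>With \<open>x\<close> integral both alternatives of the vertex hypothesis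
        count chosen elements, and \<open>b v\<close> is below the bound because
        \<open>r > 0\<close>.\<close>
      then show "card {e \<in> S. v \<in> Q e} \<le> b v + 2 * r - 2" for v
        using less.prems(3)[of v] count[of "\<lambda>e. v \<in> Q e"] r by auto
    qed
  next
    case False
    \<comment> \<open>If \<open>e\<close> were the only fractional element of its part,
      \<open>x e\<close> would be a difference of two integers, yet it lies strictly between 0 and
      1.\<close>
    have twin: "\<exists>d\<in>F. d \<noteq> e \<and> p d = p e" if e: "e \<in> F" for e
    proof (rule ccontr)
      assume no: "\<not> ?thesis"
      define A where "A = {d \<in> X. p d = p e}"
      have A: "finite A" "e \<in> A" using X e FX by (auto simp: A_def)
      have "real (n (p e)) = x e + (\<Sum>d\<in>A - {e}. x d)"
        using less.prems(2)[of "p e"] A by (simp add: A_def[symmetric] sum.remove)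
      also have "(\<Sum>d\<in>A - {e}. x d) = (\<Sum>d\<in>A - {e}. of_bool (x d > 0))"
        using no by (intro sum.cong refl int) (auto simp: A_def)
      also have "\<dots> = real (card {d \<in> A - {e}. x d > 0})"
        using A by (simp add: sum_of_bool_eq_card del: sum_of_bool_eq)
      finally have "x e = real_of_int (int (n (p e)) - int (card {d \<in> A - {e}. x d > 0}))"
        by simp
      then obtain m :: int where "x e = of_int m" by blast
      then show False using e by (auto simp: F_def)
    qed
    obtain y where y: "\<exists>e\<in>F. y e \<noteq> (0::real)" "\<And>i. (\<Sum>e | e \<in> F \<and> p e = i. y e) = 0"
      "\<And>v. card {e \<in> F. v \<in> Q e} \<ge> 2 * r \<Longrightarrow> (\<Sum>e | e \<in> F \<and> v \<in> Q e. y e) = 0"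
      using balanced_direction[where p = p and Q = Q, OF finF False r Q[OF subsetD[OF FX]] twin] by blast
    obtain t where t: "\<And>e. e \<in> F \<Longrightarrow> 0 \<le> x e + t * y e \<and> x e + t * y e \<le> 1"
      "\<exists>e\<in>F. x e + t * y e = 0 \<or> x e + t * y e = 1"
      using shift_to_boundary[OF finF _ y(1), of x] unfolding F_def by blast
    define z where "z = (\<lambda>e. if e \<in> F then x e + t * y e else x e)"
    have zsum: "(\<Sum>e | e \<in> X \<and> P e. z e) = (\<Sum>e | e \<in> X \<and> P e. x e) + t * (\<Sum>e | e \<in> F \<and> P e. y e)" for P
    proof -
      have "(\<Sum>e | e \<in> X \<and> P e. z e) = (\<Sum>e | e \<in> X \<and> P e. x e + (if e \<in> F then t * y e else 0))"
        by (intro sum.cong) (auto simp: z_def)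
      also have "\<dots> = (\<Sum>e | e \<in> X \<and> P e. x e) + (\<Sum>e | e \<in> X \<and> P e \<and> e \<in> F. t * y e)"
        using X by (simp add: sum.distrib sum.inter_filter[symmetric] conj_assoc)
      also have "{e. e \<in> X \<and> P e \<and> e \<in> F} = {e. e \<in> F \<and> P e}" using FX by auto
      finally show ?thesis by (simp add: sum_distrib_left)
    qed
    \<comment> \<open>Only elements of \<open>F\<close> change, and these are positive already, so
      the support never grows.\<close>
    have supp: "x e > 0" if "z e > 0" for e
      using that by (auto simp: z_def F_def split: if_splits)
    show ?thesis
    proof (rule less.hyps[of z])
      obtain d where "d \<in> F" "x d + t * y d = 0 \<or> x d + t * y d = 1" using t(2) by blast
      then have "d \<in> F - {e \<in> X. 0 < z e \<and> z e < 1}" by (auto simp: z_def)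
      moreover have "{e \<in> X. 0 < z e \<and> z e < 1} \<subseteq> F"
        by (auto simp: z_def F_def split: if_splits)
      ultimately have "{e \<in> X. 0 < z e \<and> z e < 1} \<subset> F" by blast
      then show "card {e \<in> X. 0 < z e \<and> z e < 1} < card {e \<in> X. 0 < x e \<and> x e < 1}"
        using finF by (simp add: F_def psubset_card_mono)
      show "0 \<le> z e \<and> z e \<le> 1" if "e \<in> X" for e
        using t(1)[of e] less.prems(1)[OF that] by (simp add: z_def)
      show "(\<Sum>e | e \<in> X \<and> p e = i. z e) = real (n i)" for i
        using zsum[of "\<lambda>e. p e = i"] y(2)[of i] less.prems(2)[of i] by simp
    next
      fix v
      let ?B = "b v + 2 * r - 2"
      define X' where "X' = {e \<in> X. v \<in> Q e}"
      define F' where "F' = {e \<in> F. v \<in> Q e}"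
      have fin': "finite X'" "finite F'" "F' \<subseteq> X'" using X FX finF by (auto simp: X'_def F'_def)
      have mono: "card {e \<in> X. v \<in> Q e \<and> z e > 0} \<le> card {e \<in> X. v \<in> Q e \<and> x e > 0}"
        using X supp by (intro card_mono) auto
      show "(\<Sum>e | e \<in> X \<and> v \<in> Q e. z e) \<le> real (b v) \<or> card {e \<in> X. v \<in> Q e \<and> z e > 0} \<le> ?B"
      proof (cases "card {e \<in> X. v \<in> Q e \<and> x e > 0} \<le> ?B")
        case True
        then show ?thesis using mono by linarith
      next
        case big: False
        then have le: "(\<Sum>e | e \<in> X \<and> v \<in> Q e. x e) \<le> real (b v)" using less.prems(3)[of v] by simp
        consider "card F' \<ge> 2 * r" | "F' = {}" | "card F' < 2 * r" "F' \<noteq> {}" by linarith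
        then show ?thesis
        proof cases
          case 1
          then show ?thesis using zsum[of "\<lambda>e. v \<in> Q e"] y(3)[of v] le by (simp add: F'_def)
        next
          case 2
          then have "(\<Sum>e | e \<in> F \<and> v \<in> Q e. y e) = 0" unfolding F'_def by (simp only: sum.empty)
          then show ?thesis using zsum[of "\<lambda>e. v \<in> Q e"] le by simp
        next
          \<comment> \<open>The vertex constraint is abandoned here. The fractional elements
            contribute a strictly positive amount, so at most \<open>b v - 1\<close> elements at
            \<open>v\<close> have value 1; at most \<open>2 * r - 1\<close> are fractional. Together
            this is \<open>b v + 2 * r - 2\<close>.\<close>
          case 3
          define O' where "O' = {e \<in> X' - F'. x e > 0}"
          have "real (card O') = (\<Sum>e\<in>X' - F'. of_bool (x e > 0))"
            using fin' by (simp add: O'_def sum_of_bool_eq_card del: sum_of_bool_eq)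
          also have "\<dots> = (\<Sum>e\<in>X' - F'. x e)"
            by (intro sum.cong refl int[symmetric]) (auto simp: X'_def F'_def)
          also have "\<dots> < (\<Sum>e\<in>X' - F'. x e) + (\<Sum>e\<in>F'. x e)"
            using 3 fin' by (auto intro!: sum_pos simp: F'_def F_def)
          also have "\<dots> = (\<Sum>e\<in>X'. x e)"
            using fin' by (simp add: sum.subset_diff[of F' X'])
          also have "\<dots> \<le> real (b v)" using le by (simp add: X'_def)
          finally have "card O' < b v" by simp
          moreover have "finite (O' \<union> F')" using fin' by (simp add: O'_def)
          then have "card {e \<in> X. v \<in> Q e \<and> x e > 0} \<le> card (O' \<union> F')"
            by (rule card_mono) (auto simp: O'_def X'_def F'_def)
          moreover have "card (O' \<union> F') \<le> card O' + card F'" by (rule card_Un_le)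
          ultimately have "card {e \<in> X. v \<in> Q e \<and> x e > 0} \<le> ?B" using 3 by linarith
          then show ?thesis using big by simp
        qed
      qed
    qed
  qed
qed

section \<open>Decomposition into permutations\<close>

lemma simple_graph_edgeE:
  assumes "fin_simple_graph V E" "e \<in> E" "v \<in> e"
  obtains w where "e = {v, w}" "v \<noteq> w" "v \<in> V" "w \<in> V"
proof -
  from assms have "e \<subseteq> V" "card e = 2" by (auto simp: fin_simple_graph_def)
  then obtain a b where "e = {a, b}" "a \<noteq> b" by (auto simp: card_2_iff)
  with assms \<open>e \<subseteq> V\<close> that show thesis by (metis insert_commute insert_iff singletonD subset_iff)
qed

lemma fin_simple_graph_finite_edges: "fin_simple_graph V E \<Longrightarrow> finite E"
  by (rule finite_subset[of E "Pow V"]) (auto simp: fin_simple_graph_def)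

text \<open>Orienting an edge means choosing its head. Half weights on both ends give every edge
  total 1 and every vertex at most \<open>k\<close>; each choice touches only its head, so
  \<open>r = 1\<close> and rounding keeps in-degrees at most \<open>k\<close>. As there are
  \<open>k * card V\<close> edges, no in-degree can be smaller.\<close>

lemma regular_graph_balanced_orientation:
  assumes G: "fin_simple_graph V E" and reg: "regular_graph (2 * k) V E"
  shows "\<exists>A\<subseteq>V \<times> V. E = (\<lambda>(u, v). {u, v}) ` A \<and> (\<forall>u v. (u, v) \<in> A \<longrightarrow> u \<noteq> v \<and> (v, u) \<notin> A) \<and>
    (\<forall>v\<in>V. card {w. (v, w) \<in> A} = k \<and> card {u. (u, v) \<in> A} = k)"
proof -
  have finV: "finite V" and finE: "finite E"
    using G fin_simple_graph_finite_edges by (auto simp: fin_simple_graph_def)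
  have E: "e \<subseteq> V" "card e = 2" "finite e" if "e \<in> E" for e
    using G that finV by (auto simp: fin_simple_graph_def intro: finite_subset)
  have deg: "card {e \<in> E. v \<in> e} = 2 * k" if "v \<in> V" for v
    using reg that by (auto simp: regular_graph_def vertex_degree_def)
  \<comment> \<open>The incidences (edge, end); selecting \<open>(e, v)\<close> makes
    \<open>v\<close> the head of \<open>e\<close>.\<close>
  define X where "X = Sigma E (\<lambda>e. e)"
  have finX: "finite X" unfolding X_def using finE E by auto
  have "\<exists>S\<subseteq>X. (\<forall>e. card {z \<in> S. fst z = e} = (if e \<in> E then 1 else 0)) \<and>
      (\<forall>v. card {z \<in> S. v \<in> {snd z}} \<le> k + 2 * 1 - 2)"
  proof (rule bounded_degree_rounding[where x = "\<lambda>_. 1/2"])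
    show "(\<Sum>z | z \<in> X \<and> fst z = e. 1/2) = real (if e \<in> E then 1 else 0)" for e
    proof -
      have "{z. z \<in> X \<and> fst z = e} = (if e \<in> E then {e} \<times> e else {})"
        by (auto simp: X_def)
      then show ?thesis using E by (auto simp: card_cartesian_product)
    qed
    fix v
    have "{z. z \<in> X \<and> v \<in> {snd z}} = {e \<in> E. v \<in> e} \<times> {v}"
      by (auto simp: X_def)
    then have "card {z. z \<in> X \<and> v \<in> {snd z}} = card {e \<in> E. v \<in> e}"
      by (simp add: card_cartesian_product)
    also have "\<dots> \<le> 2 * k"
    proof (cases "v \<in> V")
      case False
      then have "{e \<in> E. v \<in> e} = {}" using E by auto
      then show ?thesis by (simp only: card.empty)
    qed (simp add: deg)
    finally show "(\<Sum>z | z \<in> X \<and> v \<in> {snd z}. 1/2) \<le> real k \<or>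
        card {z \<in> X. v \<in> {snd z} \<and> (0::real) < 1/2} \<le> k + 2 * 1 - 2"
      by simp
  qed (use finX in auto)
  then obtain S where S: "S \<subseteq> X" "\<And>e. e \<in> E \<Longrightarrow> card {z \<in> S. fst z = e} = 1"
    "\<And>v. card {z \<in> S. snd z = v} \<le> k"
    by (auto simp: eq_commute[of _ "snd _"])
  have finS: "finite S" using S finX finite_subset by blast
  have "snd ` X \<subseteq> V" unfolding X_def using E(1) by fastforce
  then have ends: "fst ` S \<subseteq> E" "snd ` S \<subseteq> V" using S(1) by (auto simp: X_def)
  have "card S = (\<Sum>e\<in>E. card {z \<in> S. fst z = e})"
    using sum.group[OF finS finE ends(1), of "\<lambda>_. 1::nat"] by simp
  then have cS: "card S = card E" using S by simp
  have "2 * card E = (\<Sum>e\<in>E. card (e \<inter> V))"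
    using E by (simp add: Int_absorb2)
  also have "\<dots> = (\<Sum>v\<in>V. card {e \<in> E. v \<in> e})"
    using double_count_incidences[OF finE finV, of "\<lambda>e. e"] by simp
  finally have "card E = k * card V" using deg by simp
  moreover have "card S = (\<Sum>v\<in>V. card {z \<in> S. snd z = v})"
    using sum.group[OF finS finV ends(2), of "\<lambda>_. 1::nat"] by simp
  ultimately have eq: "(\<Sum>v\<in>V. card {z \<in> S. snd z = v}) = (\<Sum>v\<in>V. k)"
    using cS by (simp add: mult.commute)
  have indeg: "card {z \<in> S. snd z = v} = k" if "v \<in> V" for v
    using sum_mono_inv[OF eq S(3) that finV] .
  have one: "({u, v}, u) \<in> S \<longleftrightarrow> ({u, v}, v) \<notin> S" if e: "{u, v} \<in> E" "u \<noteq> v" for u v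
  proof -
    obtain z where z: "{z \<in> S. fst z = {u, v}} = {z}"
      using S(2)[OF e(1)] by (meson card_1_singletonE)
    have "({u, v}, w) \<in> {z \<in> S. fst z = {u, v}} \<longleftrightarrow> ({u, v}, w) \<in> {z}" for w
      by (simp only: z)
    then have S_iff: "({u, v}, w) \<in> S \<longleftrightarrow> z = ({u, v}, w)" for w
      by auto
    have "z \<in> {z \<in> S. fst z = {u, v}}" by (simp only: z singletonI)
    then have "fst z = {u, v}" "snd z \<in> fst z" using S(1) by (auto simp: X_def)
    then show ?thesis using e(2) by (cases z) (auto simp: S_iff)
  qed
  define A where "A = {(u, v). u \<noteq> v \<and> ({u, v}, v) \<in> S}"
  have AE: "{u, v} \<in> E" if "(u, v) \<in> A" for u v
    using that S(1) by (auto simp: A_def X_def)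
  have AV: "A \<subseteq> V \<times> V"
    using AE E by fastforce
  have "E = (\<lambda>(u, v). {u, v}) ` A"
  proof
    show "E \<subseteq> (\<lambda>(u, v). {u, v}) ` A"
    proof
      fix e assume e: "e \<in> E"
      then obtain u v where uv: "e = {u, v}" "u \<noteq> v" using E(2) by (metis card_2_iff)
      then have "(u, v) \<in> A \<or> (v, u) \<in> A"
        using one[of u v] e by (auto simp: A_def insert_commute)
      then show "e \<in> (\<lambda>(u, v). {u, v}) ` A"
        using uv by (force simp: insert_commute)
    qed
  qed (use AE in auto)
  moreover have "u \<noteq> v \<and> (v, u) \<notin> A" if "(u, v) \<in> A" for u v
    using that one[of u v] AE by (auto simp: A_def insert_commute)
  moreover have inA: "card {u. (u, v) \<in> A} = k" if v: "v \<in> V" for v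
  proof -
    have "bij_betw (\<lambda>u. ({u, v}, v)) {u. (u, v) \<in> A} {z \<in> S. snd z = v}"
    proof (rule bij_betw_imageI)
      show "inj_on (\<lambda>u. ({u, v}, v)) {u. (u, v) \<in> A}"
        by (auto simp: inj_on_def doubleton_eq_iff)
      show "(\<lambda>u. ({u, v}, v)) ` {u. (u, v) \<in> A} = {z \<in> S. snd z = v}"
      proof (intro equalityI subsetI)
        fix z assume z: "z \<in> {z \<in> S. snd z = v}"
        then obtain e where ze: "z = (e, v)" "e \<in> E" "v \<in> e" using S(1) by (cases z) (auto simp: X_def)
        then obtain u where "e = {v, u}" "v \<noteq> u" using simple_graph_edgeE[OF G] by metis
        then show "z \<in> (\<lambda>u. ({u, v}, v)) ` {u. (u, v) \<in> A}"
          using z ze by (auto simp: A_def insert_commute)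
      qed (auto simp: A_def)
    qed
    then show ?thesis using indeg[OF v] by (simp add: bij_betw_same_card)
  qed
  moreover have "card {w. (v, w) \<in> A} = k" if v: "v \<in> V" for v
  proof -
    \<comment> \<open>Out-neighbours and in-neighbours together account for the \<open>2 * k\<close>
      edges at \<open>v\<close>, and the in-neighbours are \<open>k\<close> of them.\<close>
    have "bij_betw (\<lambda>w. {v, w}) ({w. (v, w) \<in> A} \<union> {w. (w, v) \<in> A}) {e \<in> E. v \<in> e}"
    proof (rule bij_betw_imageI)
      show "inj_on (\<lambda>w. {v, w}) ({w. (v, w) \<in> A} \<union> {w. (w, v) \<in> A})"
        by (auto simp: inj_on_def doubleton_eq_iff)
      show "(\<lambda>w. {v, w}) ` ({w. (v, w) \<in> A} \<union> {w. (w, v) \<in> A}) = {e \<in> E. v \<in> e}"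
      proof (intro equalityI subsetI)
        fix e assume "e \<in> {e \<in> E. v \<in> e}"
        then obtain w where "e = {v, w}" "v \<noteq> w" "e \<in> E" using simple_graph_edgeE[OF G, of e v] by blast
        then show "e \<in> (\<lambda>w. {v, w}) ` ({w. (v, w) \<in> A} \<union> {w. (w, v) \<in> A})"
          using one[of v w] by (auto simp: A_def insert_commute)
      next
        fix e assume "e \<in> (\<lambda>w. {v, w}) ` ({w. (v, w) \<in> A} \<union> {w. (w, v) \<in> A})"
        then obtain w where "e = {v, w}" "(v, w) \<in> A \<or> (w, v) \<in> A" by auto
        then show "e \<in> {e \<in> E. v \<in> e}" using AE[of v w] AE[of w v] by (auto simp: insert_commute)
      qed
    qed
    then have "card ({w. (v, w) \<in> A} \<union> {w. (w, v) \<in> A}) = 2 * k"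
      using deg[OF v] by (simp add: bij_betw_same_card)
    moreover have "finite {w. (v, w) \<in> A}" "finite {w. (w, v) \<in> A}"
      using AV finV by (auto intro: finite_subset[of _ V])
    moreover have "{w. (v, w) \<in> A} \<inter> {w. (w, v) \<in> A} = {}"
      using one[of v] AE by (auto simp: A_def insert_commute)
    ultimately show ?thesis using inA[OF v] by (simp add: card_Un_disjoint)
  qed
  ultimately show ?thesis using AV by blast
qed

text \<open>Equal weights on all arcs form a fractional perfect matching of tails to heads. Rounding
  with tails as parts and heads as vertices has \<open>r = 1\<close>, hence is exact and yields one
  permutation; its removal lowers both degrees by one. The injectivity clause records that no arc
  belongs to two of the permutations.\<close>

lemma regular_digraph_permutations:
  assumes "finite V" "A \<subseteq> V \<times> V"
    and "\<And>v. v \<in> V \<Longrightarrow> card {w. (v, w) \<in> A} = k \<and> card {u. (u, v) \<in> A} = k"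
  shows "\<exists>f. (\<forall>i<k. f i permutes V) \<and> A = (\<lambda>(i, v). (v, f i v)) ` ({..<k} \<times> V) \<and>
    (\<forall>v\<in>V. inj_on (\<lambda>i. f i v) {..<k})"
  using assms(2,3)
proof (induction k arbitrary: A)
  case 0
  have "(u, v) \<notin> A" for u v
  proof
    assume uv: "(u, v) \<in> A"
    then have "finite {w. (u, w) \<in> A}"
      using 0(1) assms(1) by (auto intro: finite_subset[of _ V])
    with uv 0 show False by (auto simp: card_eq_0_iff)
  qed
  then show ?case by auto
next
  case (Suc k)
  have finA: "finite A" using Suc.prems(1) assms(1) finite_subset by blast
  have "\<exists>S\<subseteq>A. (\<forall>v. card {z \<in> S. fst z = v} = (if v \<in> V then 1 else 0)) \<and>
      (\<forall>v. card {z \<in> S. v \<in> {snd z}} \<le> 1 + 2 * 1 - 2)"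
  proof (rule bounded_degree_rounding[where x = "\<lambda>_. 1 / real (Suc k)"])
    show "(\<Sum>z | z \<in> A \<and> fst z = v. 1 / real (Suc k)) = real (if v \<in> V then 1 else 0)" for v
    proof (cases "v \<in> V")
      case True
      have "{z. z \<in> A \<and> fst z = v} = Pair v ` {w. (v, w) \<in> A}" by auto
      then have "card {z. z \<in> A \<and> fst z = v} = Suc k"
        using Suc.prems(2)[OF True] by (simp add: card_image inj_on_def)
      then show ?thesis using True by simp
    next
      case False
      then have "{z. z \<in> A \<and> fst z = v} = {}" using Suc.prems(1) by auto
      then show ?thesis using False by (simp only: sum.empty) simp
    qed
    show "(\<Sum>z | z \<in> A \<and> v \<in> {snd z}. 1 / real (Suc k)) \<le> real 1 \<or>
        card {z \<in> A. v \<in> {snd z} \<and> 0 < 1 / real (Suc k)} \<le> 1 + 2 * 1 - 2" for v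
    proof (cases "v \<in> V")
      case True
      have "{z. z \<in> A \<and> v \<in> {snd z}} = (\<lambda>u. (u, v)) ` {u. (u, v) \<in> A}" by auto
      then have "card {z. z \<in> A \<and> v \<in> {snd z}} = Suc k"
        using Suc.prems(2)[OF True] by (simp add: card_image inj_on_def)
      then show ?thesis by simp
    next
      case False
      then have "{z. z \<in> A \<and> v \<in> {snd z}} = {}" using Suc.prems(1) by auto
      then show ?thesis by (simp only: sum.empty) simp
    qed
  qed (use finA in auto)
  then obtain S where S: "S \<subseteq> A" "\<And>v. v \<in> V \<Longrightarrow> card {z \<in> S. fst z = v} = 1"
    "\<And>v. card {z \<in> S. snd z = v} \<le> 1"
    by (auto simp: eq_commute[of _ "snd _"])
  have finS: "finite S" using S finA finite_subset by blast
  have "\<exists>w. \<forall>w'. (v, w') \<in> S \<longleftrightarrow> w' = w" if "v \<in> V" for v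
  proof -
    obtain z where z: "{z \<in> S. fst z = v} = {z}" using S(2)[OF \<open>v \<in> V\<close>] by (meson card_1_singletonE)
    have "(v, w) \<in> {z \<in> S. fst z = v} \<longleftrightarrow> (v, w) \<in> {z}" for w
      by (simp only: z)
    then have S_iff: "(v, w) \<in> S \<longleftrightarrow> z = (v, w)" for w by auto
    have "z \<in> {z \<in> S. fst z = v}" by (simp only: z singletonI)
    then show ?thesis by (cases z) (auto simp: S_iff)
  qed
  then obtain h where h: "\<And>v w. v \<in> V \<Longrightarrow> (v, w) \<in> S \<longleftrightarrow> w = h v" by metis
  \<comment> \<open>Outside \<open>V\<close> the value is \<open>v\<close>, as
    \<open>permutes\<close> demands.\<close>
  define g where "g = (\<lambda>v. if v \<in> V then h v else v)"
  have S_eq: "S = (\<lambda>v. (v, g v)) ` V"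
    using h S(1) Suc.prems(1) by (auto simp: g_def)
  have g_in: "g v \<in> V" if "v \<in> V" for v
    using that S_eq S(1) Suc.prems(1) by auto
  have "inj_on g V"
  proof (rule inj_onI)
    fix u v assume uv: "u \<in> V" "v \<in> V" "g u = g v"
    then have "(u, g u) \<in> S" "(v, g v) \<in> S" using S_eq by blast+
    then have "card {(u, g u), (v, g u)} \<le> card {z \<in> S. snd z = g u}"
      using finS uv(3) by (intro card_mono) auto
    with S(3)[of "g u"] have "card {(u, g u), (v, g u)} \<le> 1" by linarith
    then show "u = v" by (cases "u = v") auto
  qed
  then have "bij_betw g V V"
    using g_in assms(1) by (simp add: bij_betw_def endo_inj_surj image_subset_iff)
  then have g: "g permutes V"
    by (rule bij_imp_permutes) (auto simp: g_def)
  have "\<exists>f. (\<forall>i<k. f i permutes V) \<and> A - S = (\<lambda>(i, v). (v, f i v)) ` ({..<k} \<times> V) \<and>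
      (\<forall>v\<in>V. inj_on (\<lambda>i. f i v) {..<k})"
  proof (rule Suc.IH)
    show "A - S \<subseteq> V \<times> V" using Suc.prems by auto
    fix v assume v: "v \<in> V"
    obtain u where u: "u \<in> V" "g u = v" using g v by (metis permutes_in_image permutes_surj surjD)
    have "{w. (v, w) \<in> A - S} = {w. (v, w) \<in> A} - {g v}" "g v \<in> {w. (v, w) \<in> A}"
      using v S(1) S_eq by auto
    moreover have "{w. (w, v) \<in> A - S} = {w. (w, v) \<in> A} - {u}" "u \<in> {w. (w, v) \<in> A}"
      using u S(1) S_eq permutes_inj[OF g] by (auto dest: injD)
    ultimately show "card {w. (v, w) \<in> A - S} = k \<and> card {u. (u, v) \<in> A - S} = k"
      using Suc.prems(2)[OF v] by (simp add: card_Diff_singleton)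
  qed
  then obtain f where f: "\<And>i. i < k \<Longrightarrow> f i permutes V"
    "A - S = (\<lambda>(i, v). (v, f i v)) ` ({..<k} \<times> V)"
    "\<And>v. v \<in> V \<Longrightarrow> inj_on (\<lambda>i. f i v) {..<k}"
    by blast
  let ?f = "f(k := g)"
  have "A = (A - S) \<union> S" using S(1) by auto
  also have "\<dots> = (\<lambda>(i, v). (v, ?f i v)) ` ({..<Suc k} \<times> V)"
    unfolding f(2) unfolding S_eq lessThan_Suc by (force simp: image_iff)
  finally have "A = (\<lambda>(i, v). (v, ?f i v)) ` ({..<Suc k} \<times> V)" .
  moreover have "inj_on (\<lambda>i. ?f i v) {..<Suc k}" if v: "v \<in> V" for v
  proof -
    \<comment> \<open>The arc from \<open>v\<close> to \<open>g v\<close> was removed before the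
      remaining permutations were built.\<close>
    have ne: "f i v \<noteq> g v" if "i < k" for i
    proof -
      have "(v, f i v) \<in> A - S" unfolding f(2) using v that by auto
      then show ?thesis using v by (auto simp: S_eq)
    qed
    show ?thesis
      using f(3)[OF v] by (auto simp: inj_on_def less_Suc_eq ne ne[symmetric])
  qed
  ultimately show ?case
    using f(1) g by (intro exI[of _ ?f]) (auto simp: less_Suc_eq)
qed

section \<open>Linear forests\<close>

lemma vertex_degree_mono:
  assumes "finite E" "E' \<subseteq> E"
  shows "vertex_degree E' v \<le> vertex_degree E v"
  unfolding vertex_degree_def using assms by (intro card_mono) auto

lemma no_three_neighbours:
  assumes "finite E" "vertex_degree E v \<le> 2" "{v, a} \<in> E" "{v, b} \<in> E" "{v, c} \<in> E"
    and "a \<noteq> b" "a \<noteq> c" "b \<noteq> c"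
  shows False
proof -
  have "card {{v, a}, {v, b}, {v, c}} = 3"
    using assms by (auto simp: doubleton_eq_iff)
  moreover have "card {{v, a}, {v, b}, {v, c}} \<le> vertex_degree E v"
    unfolding vertex_degree_def using assms by (intro card_mono) auto
  ultimately show False using assms by simp
qed

lemma cycle_neighbours:
  assumes "is_cycle E vs" "v \<in> set vs"
  obtains a b where "a \<noteq> b" "{v, a} \<in> E" "{v, b} \<in> E" "a \<in> set vs" "b \<in> set vs"
proof -
  let ?n = "length vs"
  have n: "?n \<ge> 3" and dist: "distinct vs"
    and edge: "\<And>i. i < ?n \<Longrightarrow> {vs ! i, vs ! (Suc i mod ?n)} \<in> E"
    using assms by (auto simp: is_cycle_def)
  obtain i where i: "i < ?n" "v = vs ! i" using assms by (auto simp: in_set_conv_nth)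
  \<comment> \<open>\<open>j\<close> is the cyclic predecessor of \<open>i\<close>, and
    \<open>s\<close> below the successor; they differ because a cycle has at least three
    vertices.\<close>
  define j where "j = (if i = 0 then ?n - 1 else i - 1)"
  have j: "j < ?n" "Suc j mod ?n = i" using i n by (auto simp: j_def)
  define s where "s = Suc i mod ?n"
  have s: "s < ?n" "s \<noteq> j" using i n by (auto simp: j_def s_def mod_Suc)
  show thesis
  proof (rule that[of "vs ! s" "vs ! j"])
    show "vs ! s \<noteq> vs ! j" using s j dist by (simp add: nth_eq_iff_index_eq)
    show "{v, vs ! s} \<in> E" using edge[of i] i by (simp add: s_def)
    show "{v, vs ! j} \<in> E" using edge[of j] j i by (simp add: insert_commute)
  qed (use s j in auto)
qed

text \<open>A longest path through a vertex is closed under adjacency, hence spans the component.\<close>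

lemma linear_forestI:
  assumes G: "fin_simple_graph V E"
    and deg: "\<And>v. vertex_degree E v \<le> 2" and acyclic: "\<And>vs. \<not> is_cycle E vs"
  shows "linear_forest V E"
proof -
  have finV: "finite V" and finE: "finite E"
    using G fin_simple_graph_finite_edges by (auto simp: fin_simple_graph_def)
  have EV: "a \<in> V" "b \<in> V" "a \<noteq> b" if "{a, b} \<in> E" for a b
    using that G by (auto simp: fin_simple_graph_def dest!: bspec)
  note three = no_three_neighbours[OF finE deg]
  have "is_path_graph C (induced_edges E C)" if C: "C \<in> graph_components V E" for C
  proof -
    obtain u where u: "u \<in> V" "C = {v \<in> V. reachable E u v}"
      using C by (auto simp: graph_components_def)
    \<comment> \<open>Paths may contain \<open>u\<close> anywhere, not only at the start, so that a
      longest one cannot be extended at either end.\<close>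
    define P where "P = (\<lambda>vs. distinct vs \<and> set vs \<subseteq> V \<and> u \<in> set vs \<and>
      (\<forall>i. Suc i < length vs \<longrightarrow> {vs ! i, vs ! Suc i} \<in> E))"
    have "P [u]" using u by (auto simp: P_def)
    moreover have "length vs \<le> card V" if "P vs" for vs
      using that finV by (auto simp: P_def distinct_card[symmetric] intro: card_mono)
    ultimately obtain vs where P: "P vs" and longest: "\<And>ws. P ws \<Longrightarrow> length ws \<le> length vs"
      using ex_has_greatest_nat[of P "[u]" length "card V + 1"] by (metis Suc_eq_plus1 le_imp_less_Suc)
    let ?n = "length vs"
    have dist: "distinct vs" and sV: "set vs \<subseteq> V" and us: "u \<in> set vs"
      and edge: "\<And>i. Suc i < ?n \<Longrightarrow> {vs ! i, vs ! Suc i} \<in> E"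
      using P by (auto simp: P_def)
    have ne: "vs \<noteq> []" using us by auto
    have closed: "w \<in> set vs" if v: "v \<in> set vs" and vw: "{v, w} \<in> E" for v w
    proof (rule ccontr)
      assume w: "w \<notin> set vs"
      obtain i where i: "i < ?n" "v = vs ! i" using v by (auto simp: in_set_conv_nth)
      \<comment> \<open>At either end \<open>w\<close> would lengthen the path; at an inner vertex
        it would be a third neighbour.\<close>
      consider "i = 0" | "Suc i = ?n" | "0 < i" "Suc i < ?n" using i by linarith
      then show False
      proof cases
        case 1
        have "P (w # vs)"
          using P w vw EV[OF vw] 1 i by (auto simp: P_def nth_Cons insert_commute split: nat.splits)
        then show False using longest[of "w # vs"] by simp
      next
        case 2
        then have "v = last vs" using i ne by (simp add: last_conv_nth flip: 2)
        then have "P (vs @ [w])"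
          using P w vw EV[OF vw] 2 i
          by (auto simp: P_def nth_append) (metis Suc_lessI nat.inject)
        then show False using longest[of "vs @ [w]"] by simp
      next
        case 3
        then have "{v, vs ! (i - 1)} \<in> E" "{v, vs ! Suc i} \<in> E"
          using edge[of "i - 1"] edge[of i] i by (auto simp: insert_commute)
        moreover have "vs ! (i - 1) \<noteq> vs ! Suc i" using 3 dist by (simp add: nth_eq_iff_index_eq)
        moreover have "w \<noteq> vs ! (i - 1)" "w \<noteq> vs ! Suc i" using w 3 by auto
        ultimately show False using three[of v "vs ! (i - 1)" "vs ! Suc i" w] vw by auto
      qed
    qed
    have reach_sym: "reachable E b a" if "reachable E a b" for a b
    proof -
      have "symp (\<lambda>u v. {u, v} \<in> E)" by (auto simp: symp_def insert_commute)
      then show ?thesis using that unfolding reachable_def by (metis symp_rtranclp sympD)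
    qed
    have from_start: "reachable E (vs ! 0) (vs ! i)" if "i < ?n" for i
      using that
    proof (induction i)
      case (Suc i)
      then show ?case using edge[of i] unfolding reachable_def
        by (metis (mono_tags, lifting) Suc_lessD rtranclp.rtrancl_into_rtrancl)
    qed (simp add: reachable_def)
    have "set vs = C"
    proof
      show "set vs \<subseteq> C"
      proof
        fix v assume v: "v \<in> set vs"
        have "reachable E (vs ! 0) v" "reachable E (vs ! 0) u"
          using v us from_start by (auto simp: in_set_conv_nth)
        then have "reachable E u v"
          using reach_sym unfolding reachable_def by (meson rtranclp_trans)
        then show "v \<in> C" using v sV u by auto
      qed
      have "v \<in> set vs" if "reachable E u v" for v
        using that unfolding reachable_def
        by (induction rule: rtranclp_induct) (use us closed in auto)
      then show "C \<subseteq> set vs" using u by auto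
    qed
    moreover have "induced_edges E C = {{vs ! i, vs ! Suc i} | i. Suc i < ?n}"
    proof
      show "{{vs ! i, vs ! Suc i} | i. Suc i < ?n} \<subseteq> induced_edges E C"
        using edge \<open>set vs = C\<close> by (auto simp: induced_edges_def)
      \<comment> \<open>A chord would give an inner vertex a third neighbour, so it could only join
        the two ends of the path, and then it would close a cycle.\<close>
      have consecutive: "j = Suc i" if ij: "i < j" "j < ?n" and e: "{vs ! i, vs ! j} \<in> E" for i j
      proof (rule ccontr)
        assume "j \<noteq> Suc i"
        then have j: "Suc i < j" using ij by simp
        have "i = 0"
        proof (rule ccontr)
          assume "i \<noteq> 0"
          then have "{vs ! i, vs ! (i - 1)} \<in> E" "{vs ! i, vs ! Suc i} \<in> E"
            using edge[of "i - 1"] edge[of i] ij j by (auto simp: insert_commute)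
          moreover have "i - 1 \<noteq> Suc i" "i - 1 \<noteq> j" using ij by linarith+
          ultimately show False
            using three[of "vs ! i" "vs ! (i - 1)" "vs ! Suc i" "vs ! j"] e ij j dist
            by (simp add: nth_eq_iff_index_eq)
        qed
        moreover have "Suc j = ?n"
        proof (rule ccontr)
          assume "Suc j \<noteq> ?n"
          then have "{vs ! j, vs ! (j - 1)} \<in> E" "{vs ! j, vs ! Suc j} \<in> E"
            using edge[of "j - 1"] edge[of j] ij j by (auto simp: insert_commute)
          moreover have "j - 1 \<noteq> Suc j" "j - 1 \<noteq> i" using j by linarith+
          ultimately show False
            using three[of "vs ! j" "vs ! (j - 1)" "vs ! Suc j" "vs ! i"] e ij j dist \<open>Suc j \<noteq> ?n\<close>
            by (simp add: nth_eq_iff_index_eq insert_commute)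
        qed
        moreover have "{vs ! m, vs ! (Suc m mod ?n)} \<in> E" if "m < ?n" for m
          using that edge[of m] e \<open>i = 0\<close> \<open>Suc j = ?n\<close>
          by (cases "m = j") (auto simp: insert_commute)
        ultimately have "is_cycle E vs" using dist j by (auto simp: is_cycle_def)
        then show False using acyclic by blast
      qed
      show "induced_edges E C \<subseteq> {{vs ! i, vs ! Suc i} | i. Suc i < ?n}"
      proof
        fix e assume "e \<in> induced_edges E C"
        then have e: "e \<in> E" "e \<subseteq> set vs" using \<open>set vs = C\<close> by (auto simp: induced_edges_def)
        then have "card e = 2" using G by (auto simp: fin_simple_graph_def)
        then obtain a b where "e = {a, b}" "a \<noteq> b" by (auto simp: card_2_iff)
        with e obtain i j where ij: "i < ?n" "j < ?n" "e = {vs ! i, vs ! j}" "i \<noteq> j"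
          by (auto simp: in_set_conv_nth)
        then consider "i < j" | "j < i" by linarith
        then have "j = Suc i \<or> i = Suc j"
          using consecutive[of i j] consecutive[of j i] ij e(1) by cases (auto simp: insert_commute)
        then show "e \<in> {{vs ! i, vs ! Suc i} | i. Suc i < ?n}"
          using ij by (auto simp: insert_commute)
      qed
    qed
    ultimately show ?thesis
      unfolding is_path_graph_def using ne dist by blast
  qed
  then show ?thesis using G by (simp add: linear_forest_def)
qed

text \<open>Decompositions are handled as edge colourings, whose classes are disjoint and covering
  by construction; each class is taken on all of \<open>V\<close>.\<close>

lemma linear_arboricity_le:
  fixes h :: "'a set \<Rightarrow> nat"
  assumes G: "fin_simple_graph V E" and h: "\<And>e. e \<in> E \<Longrightarrow> h e < n"
    and deg: "\<And>i v. i < n \<Longrightarrow> vertex_degree {e \<in> E. h e = i} v \<le> 2"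
    and acyclic: "\<And>i vs. i < n \<Longrightarrow> \<not> is_cycle {e \<in> E. h e = i} vs"
  shows "linear_arboricity V E \<le> n"
proof -
  have "linear_forest V {e \<in> E. h e = i}" if "i < n" for i
    using G that deg acyclic by (intro linear_forestI) (auto simp: fin_simple_graph_def)
  then have "linear_forest_decomposition V E n (\<lambda>_. V) (\<lambda>i. {e \<in> E. h e = i})"
    using h by (auto simp: linear_forest_decomposition_def)
  then show ?thesis
    unfolding linear_arboricity_def by (intro Least_le) blast
qed

text \<open>A cycle through the new edge leaves each end of it by a second edge, which belongs to
  \<open>E\<close>. Both ends would then have degree at least 1 in \<open>E\<close>.\<close>

lemma is_cycle_insert:
  assumes "is_cycle (insert e E) vs" and "finite E" "\<not> is_cycle E vs"
    and e: "e = {u, v}" "vertex_degree E u + vertex_degree E v \<le> 1"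
  shows False
proof -
  let ?n = "length vs"
  obtain i where i: "i < ?n" "{vs ! i, vs ! (Suc i mod ?n)} = e"
    using assms(1,3) by (auto simp: is_cycle_def)
  have ge: "vertex_degree E w \<ge> 1" if "w \<in> e" for w
  proof -
    have "Suc i mod ?n < ?n" using i by (intro mod_less_divisor) auto
    then have "w \<in> set vs" using i that by auto
    then obtain a b where ab: "a \<noteq> b" "{w, a} \<in> insert e E" "{w, b} \<in> insert e E"
      using cycle_neighbours[OF assms(1)] by metis
    have "{w, a} \<noteq> {w, b}" using ab by (auto simp: doubleton_eq_iff)
    then obtain d where "d \<in> E" "w \<in> d" using ab by auto
    then have "{e \<in> E. w \<in> e} \<noteq> {}" "finite {e \<in> E. w \<in> e}" using assms(2) by auto
    then show ?thesis unfolding vertex_degree_def by (metis One_nat_def Suc_leI card_gt_0_iff)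
  qed
  show False using ge[of u] ge[of v] e by simp
qed

text \<open>Colour greedily: the at most \<open>2 * (n - 1)\<close> coloured edge ends at the ends \<open>u\<close>, \<open>v\<close> of a new
  edge leave a colour with at most one of them, so the new edge closes no cycle of that colour.\<close>

lemma greedy_linear_forest_colouring:
  fixes H :: "'a set set"
  assumes "finite H" "\<And>e. e \<in> H \<Longrightarrow> card e = 2" "\<And>v. vertex_degree H v \<le> n" "n > 0"
  shows "\<exists>h. (\<forall>e\<in>H. h e < n) \<and> (\<forall>i v. vertex_degree {e \<in> H. h e = i} v \<le> 2) \<and>
    (\<forall>i vs. \<not> is_cycle {e \<in> H. h e = (i::nat)} vs)"
  using assms(1-3)
proof (induction H rule: finite_induct)
  case empty
  then show ?case
    by (intro exI[of _ "\<lambda>_. 0"]) (auto simp: vertex_degree_def is_cycle_def intro!: exI[of _ "0::nat"])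
next
  case (insert e H)
  have "vertex_degree H v \<le> n" for v
    using vertex_degree_mono[OF _ subset_insertI[of H e], of v] insert.prems(2)[of v] insert.hyps by simp
  then obtain h where h: "\<forall>e\<in>H. h e < n" "\<And>i v. vertex_degree {e \<in> H. h e = i} v \<le> 2"
    "\<And>i vs. \<not> is_cycle {e \<in> H. h e = (i::nat)} vs"
    using insert.IH insert.prems(1) by auto
  obtain u v where uv: "e = {u, v}" "u \<noteq> v" using insert.prems(1)[of e] by (auto simp: card_2_iff)
  define D where "D = (\<lambda>i w. vertex_degree {e \<in> H. h e = i} w)"
  have sum_D: "(\<Sum>i<n. D i w) = vertex_degree H w" for w
  proof -
    have "(\<Sum>i<n. D i w) = (\<Sum>i<n. card {d \<in> {d \<in> H. w \<in> d}. h d = i})"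
      unfolding D_def vertex_degree_def by (intro sum.cong arg_cong[where f = card]) auto
    also have "\<dots> = card {d \<in> H. w \<in> d}"
      using sum.group[of "{d \<in> H. w \<in> d}" "{..<n}" h "\<lambda>_. 1::nat"] insert.hyps h(1) by auto
    finally show ?thesis by (simp add: vertex_degree_def)
  qed
  \<comment> \<open>The new edge itself uses up one of the \<open>n\<close> edges allowed at
    \<open>w\<close>.\<close>
  have less: "vertex_degree H w < n" if "w \<in> e" for w
  proof -
    have "{d \<in> insert e H. w \<in> d} = insert e {d \<in> H. w \<in> d}" using that by auto
    then have "vertex_degree (insert e H) w = Suc (vertex_degree H w)"
      using insert.hyps by (simp add: vertex_degree_def)
    then show ?thesis using insert.prems(2)[of w] by simp
  qed
  obtain i where i: "i < n" "D i u + D i v \<le> 1"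
  proof (rule ccontr)
    assume "\<not> thesis"
    then have "(\<Sum>i<n. 2) \<le> (\<Sum>i<n. D i u + D i v)"
      using that by (intro sum_mono) (metis lessThan_iff not_less_eq_eq numeral_2_eq_2 One_nat_def)
    then have "2 * n \<le> vertex_degree H u + vertex_degree H v"
      by (simp add: sum.distrib sum_D)
    then show False using less[of u] less[of v] uv by simp
  qed
  define g where "g = h(e := i)"
  have colour_class: "{d \<in> insert e H. g d = j} = (if j = i then insert e {d \<in> H. h d = i} else {d \<in> H. h d = j})" for j
    using insert.hyps by (auto simp: g_def)
  show ?case
  proof (intro exI[of _ g] conjI allI)
    show "\<forall>d\<in>insert e H. g d < n" using h(1) i by (auto simp: g_def)
    show "vertex_degree {d \<in> insert e H. g d = j} w \<le> 2" for j w
    proof (cases "j = i \<and> w \<in> e")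
      case True
      then have "{d \<in> insert e {d \<in> H. h d = i}. w \<in> d} = insert e {d \<in> {d \<in> H. h d = i}. w \<in> d}" by auto
      then have "vertex_degree {d \<in> insert e H. g d = j} w = Suc (D i w)"
        using insert.hyps True colour_class[of j] by (simp add: vertex_degree_def D_def)
      moreover have "D i w \<le> 1" using True uv i by auto
      ultimately show ?thesis by simp
    next
      case False
      then have "{d \<in> {d \<in> insert e H. g d = j}. w \<in> d} = {d \<in> {d \<in> H. h d = j}. w \<in> d}"
        unfolding colour_class by auto
      then show ?thesis using h(2)[of j w] by (simp only: vertex_degree_def)
    qed
    show "\<not> is_cycle {d \<in> insert e H. g d = j} vs" for j vs
      using h(3)[of j vs] colour_class[of j] is_cycle_insert[of e "{d \<in> H. h d = i}" vs u v] uv i insert.hyps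
      by (auto simp: D_def)
  qed
qed

section \<open>Linear arboricity of regular graphs of large girth\<close>

text \<open>\<open>funpow_dist1 f v v\<close> is the first return time of \<open>v\<close>. The
  iterates before it are distinct and exhaust the orbit, and the return closes the cycle.\<close>

lemma orbit_cycle:
  assumes "v \<in> orbit f v" "\<And>u. u \<in> orbit f v \<Longrightarrow> {u, f u} \<in> E" "card (orbit f v) \<ge> 3"
  shows "\<exists>vs. is_cycle E vs \<and> length vs = card (orbit f v)"
proof -
  define m where "m = funpow_dist1 f v v"
  define vs where "vs = map (\<lambda>n. (f ^^ n) v) [0..<m]"
  have inj: "inj_on (\<lambda>n. (f ^^ n) v) {0..<m}"
    unfolding m_def by (rule inj_on_funpow_dist1[OF assms(1)])
  have orb: "orbit f v = (\<lambda>n. (f ^^ n) v) ` {0..<m}"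
    unfolding m_def by (rule orbit_conv_funpow_dist1[OF assms(1)])
  have m: "card (orbit f v) = m"
    unfolding orb using inj by (simp add: card_image)
  have period: "(f ^^ m) v = v"
    unfolding m_def by (rule funpow_dist1_prop[OF assms(1)])
  have "{vs ! i, vs ! (Suc i mod m)} \<in> E" if i: "i < m" for i
  proof -
    have "vs ! (Suc i mod m) = f ((f ^^ i) v)"
      using i period by (cases "Suc i = m") (auto simp: vs_def)
    moreover have "(f ^^ i) v \<in> orbit f v" using i by (auto simp: orb)
    ultimately show ?thesis using assms(2) i by (simp add: vs_def)
  qed
  then have "is_cycle E vs"
    using inj m assms(3) by (simp add: is_cycle_def vs_def distinct_map)
  then show ?thesis using m by (intro exI[of _ vs]) (simp add: vs_def)
qed

theorem theorem7:
  fixes k c :: nat and V :: "'a set" and E :: "'a set set"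
  assumes "k > 0" and "c > 0"
    and "fin_simple_graph V E"
    and "regular_graph (2 * k) V E"
    and "ereal_of_enat (girth E) \<ge> ereal (2 * real k / real c)"
  shows "int (linear_arboricity V E) \<le> int k + \<lceil>(3 * real c + 2) / 2\<rceil>"
proof -
  note G = assms(3)
  have finV: "finite V" using G by (simp add: fin_simple_graph_def)
  obtain A where A: "A \<subseteq> V \<times> V" "E = (\<lambda>(u, v). {u, v}) ` A"
    "\<And>u v. (u, v) \<in> A \<Longrightarrow> u \<noteq> v \<and> (v, u) \<notin> A"
    "\<And>v. v \<in> V \<Longrightarrow> card {w. (v, w) \<in> A} = k \<and> card {u. (u, v) \<in> A} = k"
    using regular_graph_balanced_orientation[OF G assms(4)] by blast
  obtain f where f: "\<And>i. i < k \<Longrightarrow> f i permutes V"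
    "A = (\<lambda>(i, v). (v, f i v)) ` ({..<k} \<times> V)" "\<And>v. v \<in> V \<Longrightarrow> inj_on (\<lambda>i. f i v) {..<k}"
    using regular_digraph_permutations[OF finV A(1,4)] by blast
  \<comment> \<open>An arc is named by its permutation and its tail; \<open>Q\<close> gives its edge
    and \<open>p\<close> its cycle. The index stays in \<open>p\<close> because different
    permutations may share an orbit as a set.\<close>
  define X where "X = {..<k} \<times> V"
  define Q where "Q = (\<lambda>(i, v). {v, f i v})"
  define p where "p = (\<lambda>(i, v). (i, orbit (f i) v))"
  have finX: "finite X" using finV by (simp add: X_def)
  have arc: "(v, f i v) \<in> A" if "(i, v) \<in> X" for i v
    using that f(2) by (auto simp: X_def)
  have EX: "E = Q ` X"
    unfolding A(2) f(2) X_def Q_def image_image by (rule image_cong) auto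
  have inj: "inj_on Q X"
  \<comment> \<open>Two names of one edge either give the same arc, excluded by the disjointness of
    the permutations, or opposite arcs, excluded by the orientation.\<close>
  proof (rule inj_onI, clarify)
    fix i v j w assume X: "(i, v) \<in> X" "(j, w) \<in> X" and "Q (i, v) = Q (j, w)"
    then consider "v = w" "f i v = f j w" | "v = f j w" "w = f i v"
      by (auto simp: Q_def doubleton_eq_iff)
    then show "i = j \<and> v = w"
    proof cases
      case 1
      then show ?thesis using f(3)[of v] X by (auto simp: X_def dest: inj_onD)
    next
      case 2
      then show ?thesis using A(3)[OF arc[OF X(1)]] arc[OF X(2)] by auto
    qed
  qed
  have Q2: "finite (Q z) \<and> card (Q z) = 2" if "z \<in> X" for z
    using that A(3)[OF arc] by (cases z) (auto simp: Q_def card_2_iff)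
  have perm: "permutation (f i)" if "i < k" for i
    using f(1)[OF that] finV by (auto simp: permutation_permutes)
  have self: "v \<in> orbit (f i) v" if "i < k" for i v
    using permutation_self_in_orbit[OF perm[OF that]] .
  have orbit_eq: "orbit (f i) w = orbit (f i) v \<longleftrightarrow> w \<in> orbit (f i) v" if "i < k" for i v w
    using cyclic_on_orbit'[OF perm[OF that]] orbit_cyclic_eq3 self[OF that] by metis
  have orbit_V: "orbit (f i) v \<subseteq> V" if "(i, v) \<in> X" for i v
    using that permutes_orbit_subset[OF f(1)] unfolding X_def by blast
  have long: "2 * real k / real c \<le> real (card (orbit (f i) v))" if z: "(i, v) \<in> X" for i v
  proof -
    have i: "i < k" using z by (simp add: X_def)
    have X: "(i, u) \<in> X" if "u \<in> orbit (f i) v" for u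
      using that orbit_V[OF z] i by (auto simp: X_def)
    have orb: "v \<in> orbit (f i) v" "f i v \<in> orbit (f i) v" "f i (f i v) \<in> orbit (f i) v"
      using self[OF i] by (auto intro: orbit.intros)
    \<comment> \<open>No loops rules out fixed points, and no opposite arcs rules out orbits of
      length 2.\<close>
    have "v \<noteq> f i v" "f i v \<noteq> f i (f i v)" "f i (f i v) \<noteq> v"
      using A(3)[OF arc[OF z]] A(3)[OF arc[OF X[OF orb(2)]]] arc[OF X[OF orb(2)]] by auto
    then have "card {v, f i v, f i (f i v)} = 3" by auto
    moreover have "card {v, f i v, f i (f i v)} \<le> card (orbit (f i) v)"
      using orb orbit_V[OF z] finV by (intro card_mono) (auto intro: finite_subset)
    ultimately have "card (orbit (f i) v) \<ge> 3" by simp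
    moreover have "{u, f i u} \<in> E" if "u \<in> orbit (f i) v" for u
      using X[OF that] by (auto simp: EX Q_def)
    ultimately obtain vs where "is_cycle E vs" "length vs = card (orbit (f i) v)"
      using orbit_cycle[OF orb(1), of E] by blast
    then have "girth E \<le> enat (card (orbit (f i) v))"
      unfolding girth_def by (metis INF_lower mem_Collect_eq)
    then have "ereal_of_enat (girth E) \<le> ereal (real (card (orbit (f i) v)))"
      by (metis ereal_of_enat_le_iff ereal_of_enat_simps(1))
    then have "ereal (2 * real k / real c) \<le> ereal (real (card (orbit (f i) v)))"
      using assms(5) by (rule order_trans[rotated])
    then show ?thesis by simp
  qed
  have incident: "{z \<in> X. w \<in> Q z} \<subseteq> (\<lambda>i. (i, w)) ` {..<k} \<union> (\<lambda>i. (i, inv (f i) w)) ` {..<k}" for w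
  proof
    fix z assume "z \<in> {z \<in> X. w \<in> Q z}"
    then obtain i v where z: "z = (i, v)" "i < k" "w = v \<or> w = f i v"
      by (cases z) (auto simp: X_def Q_def)
    then have "v = w \<or> v = inv (f i) w" using permutes_inverses(2)[OF f(1)] by auto
    then show "z \<in> (\<lambda>i. (i, w)) ` {..<k} \<union> (\<lambda>i. (i, inv (f i) w)) ` {..<k}"
      using z by auto
  qed
  have "\<exists>S\<subseteq>X. (\<forall>P. card {z \<in> S. p z = P} = (if P \<in> p ` X then 1 else 0)) \<and>
      (\<forall>w. card {z \<in> S. w \<in> Q z} \<le> c + 2 * 2 - 2)"
  proof (rule bounded_degree_rounding[where x = "\<lambda>(i, v). 1 / real (card (orbit (f i) v))"])
    fix P
    let ?s = "\<Sum>z | z \<in> X \<and> p z = P. case z of (i, v) \<Rightarrow> 1 / real (card (orbit (f i) v))"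
    show "?s = real (if P \<in> p ` X then 1 else 0)"
    proof (cases "P \<in> p ` X")
      case True
      then obtain i v where P: "(i, v) \<in> X" "P = (i, orbit (f i) v)" by (auto simp: p_def)
      let ?O = "orbit (f i) v"
      have i: "i < k" using P by (simp add: X_def)
      have "{z. z \<in> X \<and> p z = P} = {i} \<times> ?O"
        using orbit_eq[OF i] orbit_V[OF P(1)] i by (auto simp: p_def P X_def)
      then have "?s = (\<Sum>z\<in>{i} \<times> ?O. 1 / real (card ?O))"
        using orbit_eq[OF i] by (intro sum.cong) (auto, metis)
      also have "\<dots> = 1"
        using orbit_nonempty[of "f i" v] orbit_V[OF P(1)] finV
        by (simp add: card_cartesian_product card_eq_0_iff finite_subset)
      finally show ?thesis using True by simp
    next
      case False
      then have none: "{z. z \<in> X \<and> p z = P} = {}" by auto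
      show ?thesis unfolding none using False by simp
    qed
  next
    fix w
    let ?Xw = "{z. z \<in> X \<and> w \<in> Q z}"
    \<comment> \<open>The largest possible weight of an arc, by the girth bound; \<open>k\<close>
      arcs leave and \<open>k\<close> enter \<open>w\<close>, and \<open>2 * k\<close> times this is
      \<open>c\<close>.\<close>
    let ?B = "real c / (2 * real k)"
    have "card ?Xw \<le> card ((\<lambda>i. (i, w)) ` {..<k} \<union> (\<lambda>i. (i, inv (f i) w)) ` {..<k})"
      using incident by (intro card_mono) auto
    also have "\<dots> \<le> k + k"
      by (rule order_trans[OF card_Un_le]) (intro add_mono order_trans[OF card_image_le]; simp)
    finally have card: "card ?Xw \<le> 2 * k" by simp
    have "(case z of (i, v) \<Rightarrow> 1 / real (card (orbit (f i) v))) \<le> ?B" if zX: "z \<in> ?Xw" for z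
    proof -
      obtain i v where z: "z = (i, v)" "(i, v) \<in> X" using zX by (cases z) auto
      have "0 < 2 * real k / real c" using assms(1,2) by simp
      then have "1 / real (card (orbit (f i) v)) \<le> 1 / (2 * real k / real c)"
        using long[OF z(2)] by (intro divide_left_mono mult_pos_pos) linarith+
      then show ?thesis by (simp add: z)
    qed
    then have "(\<Sum>z\<in>?Xw. case z of (i, v) \<Rightarrow> 1 / real (card (orbit (f i) v))) \<le> real (card ?Xw) * ?B"
      by (rule sum_bounded_above)
    also have "\<dots> \<le> real (2 * k) * ?B"
      using card by (intro mult_right_mono) (simp_all only: of_nat_le_iff, simp)
    also have "\<dots> = real c" using assms(1) by simp
    finally show "(\<Sum>z\<in>?Xw. case z of (i, v) \<Rightarrow> 1 / real (card (orbit (f i) v))) \<le> real c \<or>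
        card {z \<in> X. w \<in> Q z \<and> 0 < (case z of (i, v) \<Rightarrow> 1 / real (card (orbit (f i) v)))} \<le> c + 2 * 2 - 2"
      by blast
  next
    fix z assume "z \<in> X"
    then obtain i v where z: "z = (i, v)" "(i, v) \<in> X" by (cases z) auto
    have "card (orbit (f i) v) \<ge> 1"
      using orbit_nonempty[of "f i" v] orbit_V[OF z(2)] finV
      by (simp add: Suc_le_eq card_gt_0_iff finite_subset)
    then show "0 \<le> (case z of (i, v) \<Rightarrow> 1 / real (card (orbit (f i) v))) \<and>
        (case z of (i, v) \<Rightarrow> 1 / real (card (orbit (f i) v))) \<le> 1"
      by (simp add: z)
  qed (use finX Q2 in auto)
  then obtain S where S: "S \<subseteq> X" "\<And>P. P \<in> p ` X \<Longrightarrow> card {z \<in> S. p z = P} = 1"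
    "\<And>w. card {z \<in> S. w \<in> Q z} \<le> c + 2"
    by auto
  have hit: "\<exists>u\<in>orbit (f i) v. (i, u) \<in> S" if z: "(i, v) \<in> X" for i v
  proof -
    have i: "i < k" using z by (simp add: X_def)
    have "card {z \<in> S. p z = p (i, v)} = 1" using S(2) z by blast
    then obtain z where "z \<in> S" "p z = p (i, v)" by (metis (mono_tags, lifting) card_1_singletonE insertI1 mem_Collect_eq)
    then show ?thesis using orbit_eq[OF i] by (cases z) (auto simp: p_def)
  qed
  define H where "H = Q ` S"
  have HE: "H \<subseteq> E" using S(1) by (auto simp: H_def EX)
  have finS: "finite S" using S(1) finX finite_subset by blast
  have H_deg: "vertex_degree H w \<le> c + 2" for w
  proof -
    have "{d \<in> H. w \<in> d} = Q ` {z \<in> S. w \<in> Q z}" by (auto simp: H_def)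
    then have "vertex_degree H w \<le> card {z \<in> S. w \<in> Q z}"
      using finS by (simp add: vertex_degree_def card_image_le)
    then show ?thesis using S(3)[of w] by simp
  qed
  have "finite H" "\<And>d. d \<in> H \<Longrightarrow> card d = 2"
    using finS HE G by (auto simp: H_def fin_simple_graph_def)
  from greedy_linear_forest_colouring[OF this H_deg]
  obtain h where h: "\<And>d. d \<in> H \<Longrightarrow> h d < c + 2"
    "\<And>i w. vertex_degree {d \<in> H. h d = i} w \<le> 2" "\<And>i vs. \<not> is_cycle {d \<in> H. h d = (i::nat)} vs"
    by auto
  \<comment> \<open>Colours below \<open>k\<close> are the permutations without their selected arcs;
    the selected edges use the \<open>c + 2\<close> colours from \<open>k\<close> on.\<close>
  define g where "g = (\<lambda>d. if d \<in> H then k + h d else fst (inv_into X Q d))"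
  have g_lt: "g d < k" if "d \<in> E - H" for d
  proof -
    have "inv_into X Q d \<in> X" using that by (simp add: EX inv_into_into)
    then show ?thesis using that by (auto simp: g_def X_def)
  qed
  have low: "{d \<in> E. g d = i} = Q ` ({i} \<times> V - S)" if i: "i < k" for i
  proof -
    have "Q z \<in> H \<longleftrightarrow> z \<in> S" if "z \<in> X" for z
      using that S(1) inj by (auto simp: H_def inj_on_image_mem_iff)
    then have "g (Q z) = i \<longleftrightarrow> z \<notin> S \<and> fst z = i" if "z \<in> X" for z
      using that i inj by (auto simp: g_def)
    moreover have "{i} \<times> V = {z \<in> X. fst z = i}" using i by (auto simp: X_def)
    ultimately show ?thesis by (auto simp: EX)
  qed
  have high: "{d \<in> E. g d = i} = {d \<in> H. h d = i - k}" if "i \<ge> k" for i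
    using that g_lt HE by (fastforce simp: g_def)
  have "linear_arboricity V E \<le> k + (c + 2)"
  proof (rule linear_arboricity_le[OF G, of g])
    show "g d < k + (c + 2)" if "d \<in> E" for d
      using that g_lt[of d] h(1)[of d] by (cases "d \<in> H") (auto simp: g_def)
  next
    fix i w
    show "vertex_degree {d \<in> E. g d = i} w \<le> 2"
    proof (cases "i < k")
      case True
      have "{d \<in> Q ` ({i} \<times> V - S). w \<in> d} \<subseteq> Q ` {(i, w), (i, inv (f i) w)}"
        using f(1)[OF True] by (auto simp: Q_def permutes_inverses)
      then have "vertex_degree (Q ` ({i} \<times> V - S)) w \<le> card (Q ` {(i, w), (i, inv (f i) w)})"
        unfolding vertex_degree_def by (intro card_mono) auto
      also have "\<dots> \<le> card {(i, w), (i, inv (f i) w)}" by (rule card_image_le) simp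
      also have "\<dots> \<le> 2" by (simp add: card_insert_if)
      finally show ?thesis by (simp add: low[OF True])
    qed (use high h(2) in auto)
  next
    fix i vs
    show "\<not> is_cycle {d \<in> E. g d = i} vs"
    proof (cases "i < k")
      case True
      show ?thesis
      proof
        assume cyc: "is_cycle {d \<in> E. g d = i} vs"
        have edge: "u \<in> V \<and> (b = f i u \<and> (i, u) \<notin> S \<or> f i b = u)" if "{u, b} \<in> {d \<in> E. g d = i}" for u b
        proof -
          have "{u, b} \<in> Q ` ({i} \<times> V - S)" using that low[OF True] by simp
          then obtain x where x: "x \<in> V" "(i, x) \<notin> S" "{u, b} = {x, f i x}"
            by (auto simp: Q_def)
          have "f i x \<in> V" using permutes_in_image[OF f(1)[OF True]] x(1) by simp
          moreover have "u = x \<and> b = f i x \<or> u = f i x \<and> b = x"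
            using x(3) by (simp only: doubleton_eq_iff)
          ultimately show ?thesis using x by blast
        qed
        \<comment> \<open>Of the two neighbours on the cycle at most one is the preimage of
          \<open>u\<close>, so the other is \<open>f i u\<close>, reached by an arc outside
          \<open>S\<close>. The cycle thus contains a whole orbit avoiding \<open>S\<close>, against
          \<open>hit\<close>.\<close>
        have step: "u \<in> V \<and> f i u \<in> set vs \<and> (i, u) \<notin> S" if u: "u \<in> set vs" for u
        proof -
          obtain a b where ab: "a \<noteq> b" "a \<in> set vs" "b \<in> set vs"
            and "{u, a} \<in> {d \<in> E. g d = i}" "{u, b} \<in> {d \<in> E. g d = i}"
            by (rule cycle_neighbours[OF cyc u])
          then have "u \<in> V \<and> (a = f i u \<and> (i, u) \<notin> S \<or> f i a = u)"
            "u \<in> V \<and> (b = f i u \<and> (i, u) \<notin> S \<or> f i b = u)"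
            using edge by blast+
          moreover have "f i a \<noteq> u \<or> f i b \<noteq> u"
            using ab(1) permutes_inj[OF f(1)[OF True]] by (auto dest: injD)
          ultimately show ?thesis using ab by metis
        qed
        have "vs \<noteq> []" using cyc by (auto simp: is_cycle_def)
        then obtain v where v: "v \<in> set vs" by (metis list.set_sel(1))
        have "u \<in> set vs" if "u \<in> orbit (f i) v" for u
          using that by induction (use v step in auto)
        moreover have "(i, v) \<in> X" using v step True by (auto simp: X_def)
        ultimately show False using hit[of i v] step by blast
      qed
    qed (use high h(3) in auto)
  qed
  \<comment> \<open>The ceiling matters at \<open>c = 1\<close>, where 5/2 is rounded up to exactly
    3.\<close>
  moreover have "int c + 2 \<le> \<lceil>(3 * real c + 2) / 2\<rceil>"
    using assms(2) by (simp add: le_ceiling_iff)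
  ultimately show ?thesis by linarith
qed

end
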